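(* Let $M=\mathbb E[A]$ be the mean matrix of a weakly assortative block model with blocks $S_1,\dots,S_K$ ($K\ge2$) partitioning $[n]$, $|S_k|=n_k$, indexed so that $p_1\ge p_2\ge\dots\ge p_K$. Let $1<m\le\min_kn_k$. Consider matrices of the form $$X=\sum_{k=1}^K\big[\alpha_kE_{S_k}+(1-\alpha_k)I_{S_k}\big],\qquad\alpha_k\in(0,1].\tag{$*$}$$ Then: (a) SDP-1 applied with input matrix $M$ and parameter $m$ has $( * )$ as a solution (maximizer) with $\alpha_k=(m-1)/(n_k-1)$ for all $k$. (b) Let $I:=\{k:\ n_k>m\}$ and $I_1(k):=\{r\in I:\ r\le k\}$. Let $J_k:=\bigcap_{r=1}^k[q^*_r,p_r]$ and $k_0:=\max\{k:\ J_k\ne\emptyset\}$. Then SDP-13 applied with input matrix $M$, parameter $m$, and any $$\mu\in J_{k_0}\cap[p_{k_0+1},1]\qquad(\text{with }p_{K+1}:=0)$$ has $( * )$ as a solution (maximizer) with $$\alpha_k=\begin{cases}1,&k\in I_1(k_0),\\(m-1)/(n_k-1),&\text{otherwise.}\end{cases}$$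
   Context: **Block model mean.** $\Psi\in[0,1]^{K\times K}$ is symmetric with $p_k:=\Psi_{kk}$ and $q_{k\ell}:=\Psi_{k\ell}$, $k\neq\ell$. The mean matrix $M\in\mathbb R^{n\times n}$ is block constant: $M_{ij}=\Psi_{k\ell}$ for all $i\in S_k,\ j\in S_\ell$ (including the diagonal). Let $q^*_k:=\max_{\ell\ne k}q_{k\ell}$. The model is *weakly assortative* if $p_k>q^*_k$ for all $k$. **Notation.** $E_{S_k}\in\{0,1\}^{n\times n}$ is the indicator matrix of $S_k\times S_k\subset[n]^2$, and $I_{S_k}$ is the $n\times n$ identity matrix with entries outside $S_k\times S_k$ set to zero. $E_n$ is the $n\times n$ all-ones matrix, $\mathbf 1_n$ the all-ones vector, $\langle B,X\rangle=\mathrm{tr}(BX)$; $X\succeq0$ means positive semidefinite and $X\ge0$ is entrywise. **SDP-1 with input $B$ and parameter $m$:** maximize $\langle B,X\rangle$ over symmetric $X\in\mathbb R^{n\times n}$ subject to $X\mathbf 1_n=m\mathbf 1_n$, $\mathrm{diag}(X)=\mathbf 1_n$, $X\succeq0$, $X\ge0$. **SDP-13 with input $B$ and parameters $m,\mu$:** maximize $\langle B,X\rangle-\mu\langle E_n,X\rangle$ over symmetric $X\in\mathbb R^{n\times n}$ subject to $\mathrm{diag}(X)=\mathbf 1_n$, $X\mathbf 1_n\ge m\mathbf 1_n$ (entrywise), $X\succeq0$, $X\ge0$. *)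

theory Defs
  imports "HOL-Analysis.Analysis"
begin

section \<open>Matrices indexed by a finite type\<close>

text \<open>The vertex set \<open>[n]\<close> is the finite index type \<open>'n\<close>.  The pointwise \<open>1\<close> on matrices
  is the all-ones matrix, not the identity, so the constant matrices get names of their own.\<close>

definition ones_vec :: "real ^ 'n" where
  "ones_vec = (\<chi> i. 1)"

definition ones_mat :: "real ^ 'n ^ 'n" where
  "ones_mat = (\<chi> i j. 1)"

definition block_ones :: "'n set \<Rightarrow> real ^ 'n ^ 'n" where
  "block_ones T = (\<chi> i j. if i \<in> T \<and> j \<in> T then 1 else 0)"

definition block_id :: "'n set \<Rightarrow> real ^ 'n ^ 'n" where
  "block_id T = (\<chi> i j. if i = j \<and> i \<in> T then 1 else 0)"

definition diag_vec :: "real ^ 'n ^ 'n \<Rightarrow> real ^ 'n" where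
  "diag_vec X = (\<chi> i. X $ i $ i)"

definition mat_inner :: "real ^ 'n ^ 'n \<Rightarrow> real ^ 'n ^ 'n \<Rightarrow> real" where
  "mat_inner B X = trace (B ** X)"

definition symmetric_mat :: "real ^ 'n ^ 'n \<Rightarrow> bool" where
  "symmetric_mat X \<longleftrightarrow> transpose X = X"

definition psd :: "real ^ 'n ^ 'n \<Rightarrow> bool" where
  "psd X \<longleftrightarrow> symmetric_mat X \<and> (\<forall>v. 0 \<le> v \<bullet> (X *v v))"

section \<open>The semidefinite programs\<close>

text \<open>A solution is any global maximizer over the feasible set; it need not be unique.\<close>

definition sdp1_feasible :: "real \<Rightarrow> real ^ 'n ^ 'n \<Rightarrow> bool" where
  "sdp1_feasible m X \<longleftrightarrow>
     symmetric_mat X \<and> X *v ones_vec = m *s ones_vec \<and> diag_vec X = ones_vec \<and>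
     psd X \<and> (\<forall>i j. 0 \<le> X $ i $ j)"

definition sdp1_solution :: "real ^ 'n ^ 'n \<Rightarrow> real \<Rightarrow> real ^ 'n ^ 'n \<Rightarrow> bool" where
  "sdp1_solution B m X \<longleftrightarrow> is_arg_max (\<lambda>Y. mat_inner B Y) (sdp1_feasible m) X"

definition sdp13_feasible :: "real \<Rightarrow> real ^ 'n ^ 'n \<Rightarrow> bool" where
  "sdp13_feasible m X \<longleftrightarrow>
     symmetric_mat X \<and> diag_vec X = ones_vec \<and>
     (\<forall>i. (m *s ones_vec) $ i \<le> (X *v ones_vec) $ i) \<and>
     psd X \<and> (\<forall>i j. 0 \<le> X $ i $ j)"

definition sdp13_solution ::
    "real ^ 'n ^ 'n \<Rightarrow> real \<Rightarrow> real \<Rightarrow> real ^ 'n ^ 'n \<Rightarrow> bool" where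
  "sdp13_solution B m \<mu> X \<longleftrightarrow>
     is_arg_max (\<lambda>Y. mat_inner B Y - \<mu> * mat_inner ones_mat Y) (sdp13_feasible m) X"

section \<open>Block models\<close>

text \<open>Blocks are numbered \<open>1, \<dots>, K\<close>; values of \<open>\<Psi>\<close> and \<open>S\<close> at other indices are irrelevant.\<close>

definition block_partition :: "nat \<Rightarrow> (nat \<Rightarrow> 'n set) \<Rightarrow> bool" where
  "block_partition K S \<longleftrightarrow>
     disjoint_family_on S {1..K} \<and> (\<Union>k\<in>{1..K}. S k) = UNIV \<and> (\<forall>k\<in>{1..K}. S k \<noteq> {})"

definition connectivity_matrix :: "nat \<Rightarrow> (nat \<Rightarrow> nat \<Rightarrow> real) \<Rightarrow> bool" where
  "connectivity_matrix K \<Psi> \<longleftrightarrow>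
     (\<forall>k\<in>{1..K}. \<forall>l\<in>{1..K}. \<Psi> k l \<in> {0..1} \<and> \<Psi> k l = \<Psi> l k)"

definition block_mean ::
    "nat \<Rightarrow> (nat \<Rightarrow> 'n set) \<Rightarrow> (nat \<Rightarrow> nat \<Rightarrow> real) \<Rightarrow> real ^ 'n ^ 'n \<Rightarrow> bool" where
  "block_mean K S \<Psi> M \<longleftrightarrow>
     (\<forall>k\<in>{1..K}. \<forall>l\<in>{1..K}. \<forall>i\<in>S k. \<forall>j\<in>S l. M $ i $ j = \<Psi> k l)"

text \<open>The convention \<open>p\<^sub>K\<^sub>+\<^sub>1 = 0\<close> is built in.\<close>

definition p_in :: "nat \<Rightarrow> (nat \<Rightarrow> nat \<Rightarrow> real) \<Rightarrow> nat \<Rightarrow> real" where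
  "p_in K \<Psi> k = (if k \<le> K then \<Psi> k k else 0)"

definition q_star :: "nat \<Rightarrow> (nat \<Rightarrow> nat \<Rightarrow> real) \<Rightarrow> nat \<Rightarrow> real" where
  "q_star K \<Psi> k = Max ((\<lambda>l. \<Psi> k l) ` ({1..K} - {k}))"

definition weakly_assortative :: "nat \<Rightarrow> (nat \<Rightarrow> nat \<Rightarrow> real) \<Rightarrow> bool" where
  "weakly_assortative K \<Psi> \<longleftrightarrow> (\<forall>k\<in>{1..K}. q_star K \<Psi> k < p_in K \<Psi> k)"

definition J_set :: "nat \<Rightarrow> (nat \<Rightarrow> nat \<Rightarrow> real) \<Rightarrow> nat \<Rightarrow> real set" where
  "J_set K \<Psi> k = (\<Inter>r\<in>{1..k}. {q_star K \<Psi> r .. p_in K \<Psi> r})"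

definition k_zero :: "nat \<Rightarrow> (nat \<Rightarrow> nat \<Rightarrow> real) \<Rightarrow> nat" where
  "k_zero K \<Psi> = Max {k \<in> {1..K}. J_set K \<Psi> k \<noteq> {}}"

definition large_blocks :: "nat \<Rightarrow> (nat \<Rightarrow> 'n set) \<Rightarrow> real \<Rightarrow> nat set" where
  "large_blocks K S m = {k \<in> {1..K}. m < real (card (S k))}"

definition large_blocks_upto :: "nat \<Rightarrow> (nat \<Rightarrow> 'n set) \<Rightarrow> real \<Rightarrow> nat \<Rightarrow> nat set" where
  "large_blocks_upto K S m k = {r \<in> large_blocks K S m. r \<le> k}"

definition star_matrix :: "nat \<Rightarrow> (nat \<Rightarrow> 'n set) \<Rightarrow> (nat \<Rightarrow> real) \<Rightarrow> real ^ 'n ^ 'n" where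
  "star_matrix K S \<alpha> =
     (\<Sum>k\<in>{1..K}. \<alpha> k *\<^sub>R block_ones (S k) + (1 - \<alpha> k) *\<^sub>R block_id (S k))"

definition alpha_a :: "(nat \<Rightarrow> 'n set) \<Rightarrow> real \<Rightarrow> nat \<Rightarrow> real" where
  "alpha_a S m k = (m - 1) / (real (card (S k)) - 1)"

definition alpha_b ::
    "nat \<Rightarrow> (nat \<Rightarrow> 'n set) \<Rightarrow> (nat \<Rightarrow> nat \<Rightarrow> real) \<Rightarrow> real \<Rightarrow> nat \<Rightarrow> real" where
  "alpha_b K S \<Psi> m k =
     (if k \<in> large_blocks_upto K S m (k_zero K \<Psi>) then 1
      else (m - 1) / (real (card (S k)) - 1))"

end

theory Submission
  imports Defs
begin

text \<open>Both bounds hold row by row.  For \<open>i \<in> S\<^sub>k\<close> every entry of the row of \<open>M\<close> is at most \<open>p\<^sub>k\<close>.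
  If \<open>p\<^sub>k \<le> \<mu>\<close>, or if the row sum of \<open>X\<close> is exactly \<open>m\<close>, the row contributes at most
  \<open>(p\<^sub>k - \<mu>) m\<close>.  If \<open>q\<^sup>*\<^sub>k \<le> \<mu> \<le> p\<^sub>k\<close>, the entries outside the block contribute at most \<open>0\<close> and those
  inside at most \<open>p\<^sub>k - \<mu>\<close> each, because positive semidefiniteness and unit diagonal force
  \<open>X\<^sub>i\<^sub>j \<le> 1\<close>.  The claimed maximizer attains each of these row bounds.\<close>

section \<open>Objectives and row sums in terms of matrix entries\<close>

lemma symmetric_mat_nth: "symmetric_mat X \<Longrightarrow> X $ j $ i = X $ i $ j"
  unfolding symmetric_mat_def by (metis transpose_def vec_lambda_beta)

lemma symmetric_matI: "(\<And>i j. X $ i $ j = X $ j $ i) \<Longrightarrow> symmetric_mat X"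
  by (simp add: symmetric_mat_def transpose_def vec_eq_iff)

lemma mat_inner_eq_sum:
  assumes "symmetric_mat X"
  shows "mat_inner B X = (\<Sum>i\<in>UNIV. \<Sum>j\<in>UNIV. B $ i $ j * X $ i $ j)"
  unfolding mat_inner_def trace_def matrix_matrix_mult_def
  by (simp add: symmetric_mat_nth[OF assms])

text \<open>Absorbing the penalty into the entries of \<open>B\<close> turns the SDP-13 objective
  into a sum over rows, so that each row can be bounded separately.\<close>

lemma shifted_objective_eq_sum:
  assumes "symmetric_mat X"
  shows "mat_inner B X - \<mu> * mat_inner ones_mat X =
    (\<Sum>i\<in>UNIV. \<Sum>j\<in>UNIV. (B $ i $ j - \<mu>) * X $ i $ j)"
  by (simp add: mat_inner_eq_sum[OF assms] ones_mat_def sum_distrib_left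
      sum_subtractf left_diff_distrib)

lemma ones_vec_nth: "ones_vec $ i = 1"
  by (simp add: ones_vec_def)

lemma mult_ones_vec_nth: "(X *v ones_vec) $ i = (\<Sum>j\<in>UNIV. X $ i $ j)"
  by (simp add: matrix_vector_mult_def ones_vec_def)

section \<open>The positive semidefinite cone\<close>

lemma psd_add: "psd X \<Longrightarrow> psd Y \<Longrightarrow> psd (X + Y)"
  unfolding psd_def symmetric_mat_def
  by (auto simp: transpose_def vec_eq_iff matrix_vector_mult_add_rdistrib inner_add_right)

lemma psd_scaleR: "0 \<le> c \<Longrightarrow> psd X \<Longrightarrow> psd (c *\<^sub>R X)"
  unfolding psd_def symmetric_mat_def
  by (auto simp: transpose_def vec_eq_iff scaleR_matrix_vector_assoc[symmetric])

lemma psd_zero: "psd 0"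
  by (simp add: psd_def symmetric_mat_def transpose_def vec_eq_iff)

lemma psd_sum: "(\<And>k. k \<in> A \<Longrightarrow> psd (X k)) \<Longrightarrow> psd (\<Sum>k\<in>A. X k)"
  by (induction A rule: infinite_finite_induct) (auto simp: psd_zero intro: psd_add)

lemma psd_block_ones: "psd (block_ones T :: real ^ 'n ^ 'n)"
  unfolding psd_def
proof (intro conjI allI)
  show "symmetric_mat (block_ones T :: real ^ 'n ^ 'n)"
    by (rule symmetric_matI) (simp add: block_ones_def conj_commute)
  fix v :: "real ^ 'n"
  \<comment> \<open>The indicator of \<open>T \<times> T\<close> factors, so each factor takes its
    own cutoff and the double sum becomes a square.\<close>
  have "v \<bullet> (block_ones T *v v) =
      (\<Sum>i\<in>UNIV. \<Sum>j\<in>UNIV. (if i \<in> T then v $ i else 0) * (if j \<in> T then v $ j else 0))"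
    unfolding inner_vec_def matrix_vector_mult_def block_ones_def
    by (auto simp: sum_distrib_left intro!: sum.cong)
  also have "\<dots> = (\<Sum>i\<in>UNIV. if i \<in> T then v $ i else 0)\<^sup>2"
    by (simp only: power2_eq_square sum_product)
  finally show "0 \<le> v \<bullet> (block_ones T *v v)" by simp
qed

lemma psd_block_id: "psd (block_id T :: real ^ 'n ^ 'n)"
  unfolding psd_def
proof (intro conjI allI)
  show "symmetric_mat (block_id T :: real ^ 'n ^ 'n)"
    by (rule symmetric_matI) (auto simp: block_id_def)
  fix v :: "real ^ 'n"
  have "(block_id T *v v) $ i = (if i \<in> T then v $ i else 0)" for i
  proof -
    have "(block_id T *v v) $ i = (\<Sum>j\<in>UNIV. if j = i then (if i \<in> T then v $ i else 0) else 0)"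
      unfolding matrix_vector_mult_def block_id_def vec_lambda_beta
      by (intro sum.cong) auto
    then show ?thesis by simp
  qed
  then show "0 \<le> v \<bullet> (block_id T *v v)"
    unfolding inner_vec_def by (auto intro!: sum_nonneg)
qed

text \<open>The quadratic form at the difference of the basis vectors \<open>i\<close> and
  \<open>j\<close> is the sum of the two diagonal entries minus twice the entry
  \<open>X $ i $ j\<close>.\<close>

lemma psd_unit_diag_le_1:
  fixes X :: "real ^ 'n ^ 'n"
  assumes "psd X" and diag: "diag_vec X = ones_vec"
  shows "X $ i $ j \<le> 1"
proof -
  have unit: "X $ k $ k = 1" for k
    using diag by (simp add: diag_vec_def ones_vec_def vec_eq_iff)
  have sym: "X $ j $ i = X $ i $ j"
    using assms(1) by (simp add: psd_def symmetric_mat_nth)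
  let ?v = "axis i 1 - axis j 1 :: real ^ 'n"
  have "0 \<le> ?v \<bullet> (X *v ?v)"
    using assms(1) by (simp add: psd_def)
  also have "\<dots> = 2 - 2 * X $ i $ j"
    by (simp add: inner_diff_left inner_axis' matrix_vector_mult_diff_distrib
        matrix_vector_mult_basis column_def unit sym)
  finally show ?thesis by simp
qed

section \<open>Entries, row sums and feasibility of the block matrices\<close>

lemma block_partition_cover:
  assumes "block_partition K S"
  obtains k where "k \<in> {1..K}" "i \<in> S k"
  using assms unfolding block_partition_def by blast

text \<open>By disjointness only the summand of the block containing \<open>i\<close> reaches row
  \<open>i\<close>; on the diagonal its two terms add up to 1.\<close>

lemma star_matrix_nth:
  assumes "block_partition K S" and k: "k \<in> {1..K}" and i: "i \<in> S k"
  shows "star_matrix K S \<alpha> $ i $ j = (if i = j then 1 else if j \<in> S k then \<alpha> k else 0)"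
proof -
  have notin: "i \<notin> S l" if "l \<in> {1..K}" "l \<noteq> k" for l
    using assms that unfolding block_partition_def disjoint_family_on_def by blast
  have "star_matrix K S \<alpha> $ i $ j =
      (\<Sum>l\<in>{1..K}. \<alpha> l * block_ones (S l) $ i $ j + (1 - \<alpha> l) * block_id (S l) $ i $ j)"
    by (simp add: star_matrix_def)
  also have "\<dots> = (\<Sum>l\<in>{1..K}. if l = k then (if i = j then 1 else if j \<in> S k then \<alpha> k else 0) else 0)"
    using i notin by (intro sum.cong) (auto simp: block_ones_def block_id_def)
  finally show ?thesis using k by simp
qed

lemma star_matrix_row_sum:
  fixes S :: "nat \<Rightarrow> 'n::finite set"
  assumes "block_partition K S" "k \<in> {1..K}" and i: "i \<in> S k"
  shows "(\<Sum>j\<in>UNIV. star_matrix K S \<alpha> $ i $ j) = 1 + (real (card (S k)) - 1) * \<alpha> k"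
proof -
  \<comment> \<open>The diagonal entry 1 is split as \<open>(1 - \<alpha> k) + \<alpha> k\<close>,
    which makes the rest constant on the block.\<close>
  have "(\<Sum>j\<in>UNIV. star_matrix K S \<alpha> $ i $ j) =
      (\<Sum>j\<in>UNIV. if i = j then 1 - \<alpha> k else 0) + (\<Sum>j\<in>UNIV. if j \<in> S k then \<alpha> k else 0)"
    unfolding sum.distrib[symmetric]
    using i by (intro sum.cong) (auto simp: star_matrix_nth[OF assms])
  also have "\<dots> = 1 - \<alpha> k + real (card (S k)) * \<alpha> k"
    by (simp add: sum.If_cases)
  finally show ?thesis by (simp add: algebra_simps)
qed

text \<open>The row vanishes outside the block, and inside it \<open>M\<close> is constant, so the
  objective is a multiple of the row sum.\<close>

lemma star_matrix_row_objective:
  fixes M :: "real ^ 'n ^ 'n"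
  assumes "block_partition K S" "block_mean K S \<Psi> M" "k \<in> {1..K}" "i \<in> S k"
  shows "(\<Sum>j\<in>UNIV. (M $ i $ j - \<mu>) * star_matrix K S \<alpha> $ i $ j) =
    (\<Psi> k k - \<mu>) * (1 + (real (card (S k)) - 1) * \<alpha> k)"
proof -
  have "(M $ i $ j - \<mu>) * star_matrix K S \<alpha> $ i $ j = (\<Psi> k k - \<mu>) * star_matrix K S \<alpha> $ i $ j" for j
    using assms by (auto simp: star_matrix_nth block_mean_def)
  then show ?thesis
    by (simp only: sum_distrib_left[symmetric] star_matrix_row_sum[OF assms(1,3,4)])
qed

text \<open>The range of \<alpha> makes both coefficients nonnegative, so this is a conic
  combination.\<close>

lemma psd_star_matrix:
  assumes "\<forall>k\<in>{1..K}. \<alpha> k \<in> {0<..1}"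
  shows "psd (star_matrix K S \<alpha>)"
  unfolding star_matrix_def using assms
  by (intro psd_sum psd_add psd_scaleR psd_block_ones psd_block_id) (auto simp: less_imp_le)

lemma diag_star_matrix:
  fixes S :: "nat \<Rightarrow> 'n::finite set"
  assumes "block_partition K S"
  shows "diag_vec (star_matrix K S \<alpha>) = ones_vec"
proof -
  have "star_matrix K S \<alpha> $ i $ i = 1" for i
    by (rule block_partition_cover[OF assms, of i]) (simp add: star_matrix_nth[OF assms])
  then show ?thesis by (simp add: diag_vec_def ones_vec_def)
qed

lemma star_matrix_nonneg:
  assumes "block_partition K S" "\<forall>k\<in>{1..K}. \<alpha> k \<in> {0<..1}"
  shows "0 \<le> star_matrix K S \<alpha> $ i $ j"
  by (rule block_partition_cover[OF assms(1), of i])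
    (use assms(2) in \<open>auto simp: star_matrix_nth[OF assms(1)] less_imp_le\<close>)

lemma sdp1_feasible_star_matrix:
  fixes S :: "nat \<Rightarrow> 'n::finite set"
  assumes part: "block_partition K S" and \<alpha>: "\<forall>k\<in>{1..K}. \<alpha> k \<in> {0<..1}"
    and row: "\<And>k. k \<in> {1..K} \<Longrightarrow> 1 + (real (card (S k)) - 1) * \<alpha> k = m"
  shows "sdp1_feasible m (star_matrix K S \<alpha>)"
proof -
  have "(star_matrix K S \<alpha> *v ones_vec) $ i = (m *s ones_vec) $ i" for i
    by (rule block_partition_cover[OF part, of i])
      (use row in \<open>auto simp: mult_ones_vec_nth star_matrix_row_sum[OF part] ones_vec_nth\<close>)
  then show ?thesis
    using psd_star_matrix[OF \<alpha>, of S] diag_star_matrix[OF part] star_matrix_nonneg[OF part \<alpha>]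
    by (simp add: sdp1_feasible_def vec_eq_iff psd_def)
qed

lemma sdp13_feasible_star_matrix:
  fixes S :: "nat \<Rightarrow> 'n::finite set"
  assumes part: "block_partition K S" and \<alpha>: "\<forall>k\<in>{1..K}. \<alpha> k \<in> {0<..1}"
    and row: "\<And>k. k \<in> {1..K} \<Longrightarrow> m \<le> 1 + (real (card (S k)) - 1) * \<alpha> k"
  shows "sdp13_feasible m (star_matrix K S \<alpha>)"
proof -
  have "(m *s ones_vec) $ i \<le> (star_matrix K S \<alpha> *v ones_vec) $ i" for i
    by (rule block_partition_cover[OF part, of i])
      (use row in \<open>auto simp: mult_ones_vec_nth star_matrix_row_sum[OF part] ones_vec_nth\<close>)
  then show ?thesis
    using psd_star_matrix[OF \<alpha>, of S] diag_star_matrix[OF part] star_matrix_nonneg[OF part \<alpha>]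
    by (simp add: sdp13_feasible_def psd_def)
qed

section \<open>Upper bounds for one row of a feasible matrix\<close>

lemma block_mean_le_q_star:
  assumes "block_partition K S" "block_mean K S \<Psi> M" "k \<in> {1..K}" "i \<in> S k" "j \<notin> S k"
  shows "M $ i $ j \<le> q_star K \<Psi> k"
proof -
  obtain l where l: "l \<in> {1..K}" "j \<in> S l"
    using block_partition_cover[OF assms(1)] .
  then have "M $ i $ j = \<Psi> k l" and "l \<noteq> k"
    using assms by (auto simp: block_mean_def)
  then show ?thesis
    using l unfolding q_star_def by (auto intro!: Max_ge)
qed

lemma block_mean_le_p:
  assumes "block_partition K S" "block_mean K S \<Psi> M" "weakly_assortative K \<Psi>"
    and "k \<in> {1..K}" "i \<in> S k"
  shows "M $ i $ j \<le> \<Psi> k k"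
proof (cases "j \<in> S k")
  case True
  then show ?thesis using assms by (auto simp: block_mean_def)
next
  case False
  have "q_star K \<Psi> k < \<Psi> k k"
    using assms by (auto simp: weakly_assortative_def p_in_def)
  then show ?thesis
    using block_mean_le_q_star[OF assms(1,2,4,5) False] by linarith
qed

text \<open>Useful when the row sum is known exactly (SDP-1), or when \<open>p \<le> \<mu>\<close>,
  so that a lower bound on the row sum suffices (SDP-13).\<close>

lemma row_objective_le_row_sum:
  fixes Y :: "real ^ 'n ^ 'n"
  assumes "\<And>j. M $ i $ j \<le> p" "\<forall>i j. 0 \<le> Y $ i $ j"
  shows "(\<Sum>j\<in>UNIV. (M $ i $ j - \<mu>) * Y $ i $ j) \<le> (p - \<mu>) * (\<Sum>j\<in>UNIV. Y $ i $ j)"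
  unfolding sum_distrib_left using assms by (intro sum_mono mult_right_mono) auto

text \<open>For rows where \<mu> separates the block from the rest. SDP-13 puts no explicit upper
  bound on row sums; the cap of 1 on each entry takes its place.\<close>

lemma row_objective_le_card:
  fixes Y :: "real ^ 'n ^ 'n"
  assumes "\<And>j. j \<in> T \<Longrightarrow> M $ i $ j = p" "\<And>j. j \<notin> T \<Longrightarrow> M $ i $ j \<le> \<mu>" "\<mu> \<le> p"
    and "\<forall>i j. 0 \<le> Y $ i $ j" "\<And>j. Y $ i $ j \<le> 1"
  shows "(\<Sum>j\<in>UNIV. (M $ i $ j - \<mu>) * Y $ i $ j) \<le> (p - \<mu>) * real (card T)"
proof -
  have "(M $ i $ j - \<mu>) * Y $ i $ j \<le> (if j \<in> T then p - \<mu> else 0)" for j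
    using assms by (auto simp: mult_left_le mult_nonpos_nonneg)
  then have "(\<Sum>j\<in>UNIV. (M $ i $ j - \<mu>) * Y $ i $ j) \<le> (\<Sum>j\<in>UNIV. if j \<in> T then p - \<mu> else 0)"
    by (intro sum_mono)
  then show ?thesis by (simp add: sum.If_cases mult.commute)
qed

section \<open>Optimality of the block matrices\<close>

lemma alpha_a_bounds:
  assumes "1 < m" "m \<le> real (card (S k))"
  shows "alpha_a S m k \<in> {0<..1}" and "1 + (real (card (S k)) - 1) * alpha_a S m k = m"
  \<comment> \<open>Both assumptions together give a block size above 1, so the division is genuine;
    the quotient is the value that makes the row sum equal to \<open>m\<close>.\<close>
  using assms by (auto simp: alpha_a_def field_simps)

lemma sdp1_solution_star_matrix:
  fixes M :: "real ^ 'n ^ 'n"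
  assumes part: "block_partition K S" and mean: "block_mean K S \<Psi> M"
    and assort: "weakly_assortative K \<Psi>"
    and \<alpha>: "\<forall>k\<in>{1..K}. \<alpha> k \<in> {0<..1}"
    and row: "\<And>k. k \<in> {1..K} \<Longrightarrow> 1 + (real (card (S k)) - 1) * \<alpha> k = m"
  shows "sdp1_solution M m (star_matrix K S \<alpha>)"
  unfolding sdp1_solution_def is_arg_max_linorder
proof (intro conjI allI impI)
  let ?X = "star_matrix K S \<alpha>"
  show X: "sdp1_feasible m ?X"
    using part \<alpha> row by (rule sdp1_feasible_star_matrix)
  fix Y :: "real ^ 'n ^ 'n" assume Y: "sdp1_feasible m Y"
  have "(\<Sum>j\<in>UNIV. M $ i $ j * Y $ i $ j) \<le> (\<Sum>j\<in>UNIV. M $ i $ j * ?X $ i $ j)" for i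
  proof -
    obtain k where k: "k \<in> {1..K}" "i \<in> S k"
      using block_partition_cover[OF part] .
    have "(\<Sum>j\<in>UNIV. Y $ i $ j) = m"
      using Y unfolding sdp1_feasible_def
      by (metis mult_ones_vec_nth ones_vec_nth vector_smult_component mult.right_neutral)
    then have "(\<Sum>j\<in>UNIV. M $ i $ j * Y $ i $ j) \<le> \<Psi> k k * m"
      \<comment> \<open>SDP-1 has no penalty, so the row bounds are taken at \<mu> = 0.\<close>
      using row_objective_le_row_sum[of M i "\<Psi> k k" Y 0]
        block_mean_le_p[OF part mean assort k] Y
      by (simp add: sdp1_feasible_def)
    then show ?thesis
      using star_matrix_row_objective[OF part mean k, of 0 \<alpha>] row[OF k(1)] by simp
  qed
  then show "mat_inner M Y \<le> mat_inner M ?X"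
    using X Y by (auto simp: sdp1_feasible_def mat_inner_eq_sum intro: sum_mono)
qed

text \<open>The assumption \<open>row\<close> is a complementarity condition for each block: either
  \<mu> lies in the block's interval and the block is filled with ones, or \<mu> is at least the
  within-block value and the row-sum constraint is tight. In both cases the matching row bound is
  attained.\<close>

lemma sdp13_solution_star_matrix:
  fixes M :: "real ^ 'n ^ 'n"
  assumes part: "block_partition K S" and mean: "block_mean K S \<Psi> M"
    and assort: "weakly_assortative K \<Psi>"
    and \<alpha>: "\<forall>k\<in>{1..K}. \<alpha> k \<in> {0<..1}"
    and feas: "\<And>k. k \<in> {1..K} \<Longrightarrow> m \<le> 1 + (real (card (S k)) - 1) * \<alpha> k"
    and row: "\<And>k. k \<in> {1..K} \<Longrightarrow>
      (q_star K \<Psi> k \<le> \<mu> \<and> \<mu> \<le> \<Psi> k k \<and> \<alpha> k = 1) \<or>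
      (\<Psi> k k \<le> \<mu> \<and> 1 + (real (card (S k)) - 1) * \<alpha> k = m)"
  shows "sdp13_solution M m \<mu> (star_matrix K S \<alpha>)"
  unfolding sdp13_solution_def is_arg_max_linorder
proof (intro conjI allI impI)
  let ?X = "star_matrix K S \<alpha>"
  show X: "sdp13_feasible m ?X"
    using part \<alpha> feas by (rule sdp13_feasible_star_matrix)
  fix Y :: "real ^ 'n ^ 'n" assume Y: "sdp13_feasible m Y"
  have "(\<Sum>j\<in>UNIV. (M $ i $ j - \<mu>) * Y $ i $ j) \<le> (\<Sum>j\<in>UNIV. (M $ i $ j - \<mu>) * ?X $ i $ j)" for i
  proof -
    obtain k where k: "k \<in> {1..K}" "i \<in> S k"
      using block_partition_cover[OF part] .
    note star = star_matrix_row_objective[OF part mean k, of \<mu> \<alpha>]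
    from row[OF k(1)] show ?thesis
    proof
      assume *: "q_star K \<Psi> k \<le> \<mu> \<and> \<mu> \<le> \<Psi> k k \<and> \<alpha> k = 1"
      have "(\<Sum>j\<in>UNIV. (M $ i $ j - \<mu>) * Y $ i $ j) \<le> (\<Psi> k k - \<mu>) * real (card (S k))"
      proof (rule row_objective_le_card)
        show "M $ i $ j = \<Psi> k k" if "j \<in> S k" for j
          using mean k that by (auto simp: block_mean_def)
        show "M $ i $ j \<le> \<mu>" if "j \<notin> S k" for j
          using block_mean_le_q_star[OF part mean k that] * by linarith
        show "Y $ i $ j \<le> 1" for j
          using Y by (simp add: sdp13_feasible_def psd_unit_diag_le_1)
      qed (use * Y in \<open>auto simp: sdp13_feasible_def\<close>)
      with star * show ?thesis by simp
    next
      assume *: "\<Psi> k k \<le> \<mu> \<and> 1 + (real (card (S k)) - 1) * \<alpha> k = m"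
      have "m \<le> (\<Sum>j\<in>UNIV. Y $ i $ j)"
        using Y by (auto simp: sdp13_feasible_def mult_ones_vec_nth[symmetric] ones_vec_nth)
      \<comment> \<open>The factor is nonpositive, so the lower bound on the row sum becomes an
        upper bound on the objective.\<close>
      then have "(\<Psi> k k - \<mu>) * (\<Sum>j\<in>UNIV. Y $ i $ j) \<le> (\<Psi> k k - \<mu>) * m"
        using * by (intro mult_left_mono_neg) auto
      moreover have "(\<Sum>j\<in>UNIV. (M $ i $ j - \<mu>) * Y $ i $ j) \<le>
          (\<Psi> k k - \<mu>) * (\<Sum>j\<in>UNIV. Y $ i $ j)"
        using block_mean_le_p[OF part mean assort k] Y
        by (intro row_objective_le_row_sum) (auto simp: sdp13_feasible_def)
      ultimately show ?thesis
        using star * by simp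
    qed
  qed
  then show "mat_inner M Y - \<mu> * mat_inner ones_mat Y \<le> mat_inner M ?X - \<mu> * mat_inner ones_mat ?X"
    using X Y by (auto simp: sdp13_feasible_def shifted_objective_eq_sum intro: sum_mono)
qed

theorem proposition6p1:
  fixes K :: nat and S :: "nat \<Rightarrow> 'n::finite set" and \<Psi> :: "nat \<Rightarrow> nat \<Rightarrow> real"
    and M :: "real ^ 'n ^ 'n" and m :: real
  assumes "K \<ge> 2"
    and "block_partition K S"
    and "connectivity_matrix K \<Psi>"
    and "block_mean K S \<Psi> M"
    and "weakly_assortative K \<Psi>"
    and "\<forall>k\<in>{1..K}. \<forall>l\<in>{1..K}. k \<le> l \<longrightarrow> p_in K \<Psi> l \<le> p_in K \<Psi> k"
    and "1 < m"
    and "m \<le> real (Min ((\<lambda>k. card (S k)) ` {1..K}))"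
  shows "((\<forall>k\<in>{1..K}. alpha_a S m k \<in> {0<..1}) \<and>
          sdp1_solution M m (star_matrix K S (alpha_a S m))) \<and>
         ((\<forall>k\<in>{1..K}. alpha_b K S \<Psi> m k \<in> {0<..1}) \<and>
          (\<forall>\<mu> \<in> J_set K \<Psi> (k_zero K \<Psi>) \<inter> {p_in K \<Psi> (k_zero K \<Psi> + 1)..1}.
             sdp13_solution M m \<mu> (star_matrix K S (alpha_b K S \<Psi> m))))"
proof -
  note part = assms(2) and mean = assms(4) and assort = assms(5)
  have size: "m \<le> real (card (S k))" if "k \<in> {1..K}" for k
  proof -
    have "Min ((\<lambda>k. card (S k)) ` {1..K}) \<le> card (S k)"
      using that by (intro Min_le) auto
    with assms(8) show ?thesis by linarith
  qed
  note a = alpha_a_bounds[of m S, OF assms(7) size]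
  let ?\<alpha> = "alpha_b K S \<Psi> m" and ?k0 = "k_zero K \<Psi>"
  \<comment> \<open>In this form the choice depends only on the position of \<open>k\<close>
    relative to \<open>?k0\<close>, which is also what decides the alternative in
    \<open>row\<close>.\<close>
  have b_eq: "?\<alpha> k = (if k \<le> ?k0 then 1 else alpha_a S m k)" if "k \<in> {1..K}" for k
  proof (cases "m < real (card (S k))")
    case True
    with that show ?thesis
      by (simp add: alpha_b_def alpha_a_def large_blocks_upto_def large_blocks_def)
  next
    case False
    then have "m = real (card (S k))" using size[OF that] by simp
    \<comment> \<open>a block of minimal size gets \<open>\<alpha>\<^sub>k = 1\<close> from either branch\<close>
    with assms(7) show ?thesis
      by (simp add: alpha_b_def alpha_a_def large_blocks_upto_def large_blocks_def)
  qed
  have b: "\<forall>k\<in>{1..K}. ?\<alpha> k \<in> {0<..1}"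
    using a(1) by (auto simp: b_eq)
  have "sdp13_solution M m \<mu> (star_matrix K S ?\<alpha>)"
    if \<mu>: "\<mu> \<in> J_set K \<Psi> ?k0 \<inter> {p_in K \<Psi> (?k0 + 1)..1}" for \<mu>
  proof (rule sdp13_solution_star_matrix[OF part mean assort b])
    fix k assume k: "k \<in> {1..K}"
    show "m \<le> 1 + (real (card (S k)) - 1) * ?\<alpha> k"
      using a(2)[OF k] size[OF k] by (simp add: b_eq[OF k])
    show "(q_star K \<Psi> k \<le> \<mu> \<and> \<mu> \<le> \<Psi> k k \<and> ?\<alpha> k = 1) \<or>
      (\<Psi> k k \<le> \<mu> \<and> 1 + (real (card (S k)) - 1) * ?\<alpha> k = m)"
    proof (cases "k \<le> ?k0")
      case True
      with \<mu> k have "\<mu> \<in> {q_star K \<Psi> k..p_in K \<Psi> k}"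
        unfolding J_set_def by auto
      with True k show ?thesis by (simp add: b_eq p_in_def)
    next
      case False
      \<comment> \<open>Here \<open>?k0 + 1 \<le> k \<le> K\<close>, so the monotonicity of
        \<open>p_in\<close> applies; the default value 0 beyond \<open>K\<close> never enters this
        case.\<close>
      then have "p_in K \<Psi> k \<le> p_in K \<Psi> (?k0 + 1)"
        using k assms(6) by auto
      with \<mu> k have "\<Psi> k k \<le> \<mu>" by (simp add: p_in_def split: if_splits)
      with False k a(2) show ?thesis by (simp add: b_eq)
    qed
  qed
  moreover have "sdp1_solution M m (star_matrix K S (alpha_a S m))"
    using a by (intro sdp1_solution_star_matrix[OF part mean assort]) auto
  ultimately show ?thesis
    using a(1) b by blast
qed

end
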